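(* Let $\varphi:S^1\to S^1$ be a semi-periodic circle homeomorphism (orientation preserving). Then for every $z\in S^1$ the displacement sequence $\{\eta_n(z)\}_{n\ge 1}$ is asymptotically periodic (and thus in particular asymptotically semi-periodic). Precisely, if $\varrho(\varphi)=p/q$, then for every $z\in S^1$: $$\forall_{\varepsilon>0}\ \exists_{N\in\mathbb{N}}\ \forall_{n>N}\ \forall_{k\in\mathbb{N}}\quad |\eta_{n+kq}(z)-\eta_n(z)|<\varepsilon .$$
   Context: $S^1$ is the unit circle in $\mathbb{C}$, covered by $\mathbb{R}$ via $x\mapsto \exp(2\pi \mathrm{i}x)$. Let $\varphi:S^1\to S^1$ be an orientation preserving homeomorphism and $\Phi:\mathbb{R}\to\mathbb{R}$ a lift of it (so $\Phi(x+1)=\Phi(x)+1$). The rotation number is $\varrho(\varphi)=\lim_{n\to\infty}\Phi^n(x)/n \bmod 1$ (independent of $x$ and of the lift). The displacement function is $\Psi(x)=\Phi(x)-x$, and the displacement sequence of $z=\exp(2\pi\mathrm{i}x)$ is $\eta_n(z)=\Psi(\Phi^{n-1}(x))\bmod 1=\Phi^n(x)-\Phi^{n-1}(x)\bmod 1\in[0,1)$, $n=1,2,\dots$; it does not depend on the choice of lift. A circle homeomorphism with rational rotation number which is not conjugated to a rotation is called semi-periodic. A real sequence $\{x_n\}$ is asymptotically periodic if there is a periodic sequence $\{a_n\}$ with $\lim_{n\to\infty}|x_n-a_n|=0$. It is asymptotically semi-periodic if $\forall_{\varepsilon>0}\ \exists_{N\in\mathbb{N}}\ \exists_{r\in\mathbb{N}}\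 \forall_{n>N}\ \forall_{k\in\mathbb{N}}\ |x_{n+rk}-x_n|<\varepsilon$. *)

theory Defs
  imports "HOL-Analysis.Analysis"
begin

definition circle_cover :: "real \<Rightarrow> complex" where
  "circle_cover x = exp (2 * of_real pi * \<i> * of_real x)"

text \<open>Circle maps are functions on \<^typ>\<open>complex\<close>; only their values on the unit circle
  \<^term>\<open>sphere (0::complex) 1\<close> matter.\<close>

definition circle_homeo :: "(complex \<Rightarrow> complex) \<Rightarrow> bool" where
  "circle_homeo \<phi> \<longleftrightarrow> (\<exists>\<psi>. homeomorphism (sphere 0 1) (sphere 0 1) \<phi> \<psi>)"

definition is_lift :: "(complex \<Rightarrow> complex) \<Rightarrow> (real \<Rightarrow> real) \<Rightarrow> bool" where
  "is_lift \<phi> \<Phi> \<longleftrightarrow>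
     continuous_on UNIV \<Phi> \<and> (\<forall>x. circle_cover (\<Phi> x) = \<phi> (circle_cover x))"

definition orientation_preserving_circle_homeo :: "(complex \<Rightarrow> complex) \<Rightarrow> bool" where
  "orientation_preserving_circle_homeo \<phi> \<longleftrightarrow>
     circle_homeo \<phi> \<and> (\<exists>\<Phi>. is_lift \<phi> \<Phi> \<and> strict_mono \<Phi>)"

text \<open>The rotation number is the representative in $[0,1)$ of the class mod 1 of
  $\lim \Phi^n(x)/n$. The description is well defined for orientation preserving
  homeomorphisms, because the limit exists and its class mod 1 depends neither on the
  lift nor on the point.\<close>

definition rotation_number :: "(complex \<Rightarrow> complex) \<Rightarrow> real" where
  "rotation_number \<phi> =
     (THE \<rho>. \<forall>\<Phi> x. is_lift \<phi> \<Phi> \<longrightarrow>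
        (\<exists>L. (\<lambda>n. (\<Phi> ^^ n) x / real n) \<longlonglongrightarrow> L \<and> \<rho> = frac L))"

definition displacement :: "(real \<Rightarrow> real) \<Rightarrow> real \<Rightarrow> real" where
  "displacement \<Phi> x = \<Phi> x - x"

text \<open>The sequence is indexed by $n \ge 1$; the value at \<open>n = 0\<close> is junk. The description
  is well defined because a different choice of the lift or of the point over \<open>z\<close> changes
  the displacement by an integer.\<close>

definition displacement_seq :: "(complex \<Rightarrow> complex) \<Rightarrow> complex \<Rightarrow> nat \<Rightarrow> real" where
  "displacement_seq \<phi> z n =
     (THE e. \<forall>\<Phi> x. is_lift \<phi> \<Phi> \<and> circle_cover x = z \<longrightarrow>
        e = frac (displacement \<Phi> ((\<Phi> ^^ (n - 1)) x)))"

definition conjugated_to_rotation :: "(complex \<Rightarrow> complex) \<Rightarrow> bool" where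
  "conjugated_to_rotation \<phi> \<longleftrightarrow>
     (\<exists>h \<alpha>. circle_homeo h \<and> (\<forall>z\<in>sphere 0 1. h (\<phi> z) = circle_cover \<alpha> * h z))"

definition semi_periodic :: "(complex \<Rightarrow> complex) \<Rightarrow> bool" where
  "semi_periodic \<phi> \<longleftrightarrow>
     orientation_preserving_circle_homeo \<phi> \<and> rotation_number \<phi> \<in> \<rat> \<and>
     \<not> conjugated_to_rotation \<phi>"

definition asymptotically_periodic :: "(nat \<Rightarrow> real) \<Rightarrow> bool" where
  "asymptotically_periodic x \<longleftrightarrow>
     (\<exists>a. (\<exists>r\<ge>1. \<forall>n. a (n + r) = a n) \<and> (\<lambda>n. \<bar>x n - a n\<bar>) \<longlonglongrightarrow> 0)"

text \<open>The period must be positive: \<open>r = 0\<close> would make the condition vacuous.\<close>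

definition asymptotically_semi_periodic :: "(nat \<Rightarrow> real) \<Rightarrow> bool" where
  "asymptotically_semi_periodic x \<longleftrightarrow>
     (\<forall>\<epsilon>>0. \<exists>N. \<exists>r\<ge>1. \<forall>n>N. \<forall>k. \<bar>x (n + r * k) - x n\<bar> < \<epsilon>)"

end

theory Submission
  imports Defs
begin

text \<open>
  The idea: if the rotation number is \<open>p / q\<close>, every lift \<open>F\<close> has, after \<open>p\<close> is adjusted by a
  multiple of \<open>q\<close>, a point with \<open>F\<^sup>q y = y + p\<close>; otherwise \<open>F\<^sup>q x - x - p\<close> would be bounded
  away from \<open>0\<close> with a constant sign, by periodicity and compactness, and the orbits would drift
  at a different speed (\<open>fixed_point_of_zero_drift\<close>). So \<open>G = F\<^sup>q - p\<close> is increasing with a fixed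
  point, and all its integer translates are fixed as well. Every orbit of \<open>G\<close> is therefore
  monotone and trapped between two fixed points, hence convergent
  (\<open>orbit_converges_to_fixed_point\<close>). Applying \<open>F\<^sup>j\<close> to the limit, every residue class of indices
  mod \<open>q\<close> gives a subsequence of displacements that converges in the reals.

  The displacement sequence is only the fractional part of these displacements, and the
  fractional part jumps at integers. If the limit is not an integer, continuity suffices. If
  some limit displacement is an integer \<open>m\<close>, the limit point \<open>w\<close> satisfies \<open>F w = w + m\<close>. Then
  \<open>F - m\<close> itself has a fixed point, its orbits are monotone, and the displacements minus \<open>m\<close>
  tend to \<open>0\<close> with a constant sign; the fractional parts then converge as well, to \<open>0\<close> from
  above or to \<open>1\<close> from below (\<open>frac_displacement_converges_subseq\<close>). In particular the limiting
  periodic sequence takes values in the closed interval \<open>[0,1]\<close>.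

  Both the rotation number and the displacement sequence are defined by a unique description
  over all lifts. They have the expected values because two lifts differ by a constant integer
  and because Poincare's limit exists (\<open>drift_converges\<close>).
\<close>

section \<open>Fractional parts and sequences split into residue classes\<close>

text \<open>The sign of the sequence has to be constant, since the limit of the fractional parts is
  \<open>0\<close> from above and \<open>1\<close> from below.\<close>

lemma convergent_frac_of_one_sided_null:
  fixes d :: "nat \<Rightarrow> real"
  assumes d: "d \<longlonglongrightarrow> 0" and sign: "(\<forall>n. d n \<ge> 0) \<or> (\<forall>n. d n < 0)"
  shows "convergent (\<lambda>n. frac (d n))"
proof -
  have small: "\<forall>\<^sub>F n in sequentially. \<bar>d n\<bar> < 1"
    using tendstoD[OF d, of 1] by (simp add: dist_real_def)
  show ?thesis
    using sign
  proof
    assume nonneg: "\<forall>n. d n \<ge> 0"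
    have "\<forall>\<^sub>F n in sequentially. d n = frac (d n)"
      using small
    proof (rule eventually_mono)
      fix n assume "\<bar>d n\<bar> < 1"
      then have "frac (d n) = d n"
        using nonneg[rule_format, of n] by (simp add: frac_eq)
      then show "d n = frac (d n)" ..
    qed
    then show ?thesis
      by (rule convergentI[OF Lim_transform_eventually[OF d]])
  next
    assume neg: "\<forall>n. d n < 0"
    have "\<forall>\<^sub>F n in sequentially. d n + 1 = frac (d n)"
      using small
    proof (rule eventually_mono)
      fix n assume "\<bar>d n\<bar> < 1"
      then have "frac (d n + 1) = d n + 1"
        using neg[rule_format, of n] unfolding frac_eq by linarith
      then show "d n + 1 = frac (d n)"
        unfolding frac_1_eq by (rule sym)
    qed
    moreover have "(\<lambda>n. d n + 1) \<longlonglongrightarrow> 0 + 1"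
      by (intro tendsto_intros d)
    ultimately show ?thesis
      by (intro convergentI[OF Lim_transform_eventually])
  qed
qed

lemma asymptotically_periodic_of_convergent_residue_classes:
  fixes e :: "nat \<Rightarrow> real"
  assumes q: "q \<ge> 1" and conv: "\<And>j. convergent (\<lambda>k. e (k * q + j))"
  obtains a where "\<And>n. a (n + q) = a n" "(\<lambda>n. \<bar>e n - a n\<bar>) \<longlonglongrightarrow> 0"
proof -
  define b where "b j = lim (\<lambda>k. e (k * q + j))" for j
  have b: "(\<lambda>k. e (k * q + j)) \<longlonglongrightarrow> b j" for j
    using conv unfolding b_def by (simp add: convergent_LIMSEQ_iff)
  have "(\<lambda>n. \<bar>e n - b (n mod q)\<bar>) \<longlonglongrightarrow> 0"
  proof (rule LIMSEQ_I)
    fix r :: real assume r: "0 < r"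
    have "\<forall>\<^sub>F k in sequentially. \<forall>j\<in>{..<q}. dist (e (k * q + j)) (b j) < r"
      using tendstoD[OF b r] by (intro eventually_ball_finite) auto
    then obtain K where K: "\<And>k j. k \<ge> K \<Longrightarrow> j < q \<Longrightarrow> dist (e (k * q + j)) (b j) < r"
      by (auto simp: eventually_sequentially)
    have "norm (\<bar>e n - b (n mod q)\<bar> - 0) < r" if "n \<ge> K * q" for n
    proof -
      have "n div q \<ge> K"
        using that q div_le_mono[of "K * q" n q] by simp
      then show ?thesis
        using K[of "n div q" "n mod q"] q by (simp add: dist_real_def)
    qed
    then show "\<exists>no. \<forall>n\<ge>no. norm (\<bar>e n - b (n mod q)\<bar> - 0) < r" by blast
  qed
  then show thesis
    by (intro that[of "\<lambda>n. b (n mod q)"]) auto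
qed

lemma uniformly_almost_periodic_of_asymptotically_periodic:
  fixes e a :: "nat \<Rightarrow> real"
  assumes per: "\<And>n. a (n + q) = a n" and lim: "(\<lambda>n. \<bar>e n - a n\<bar>) \<longlonglongrightarrow> 0" and "\<epsilon> > 0"
  shows "\<exists>N. \<forall>n>N. \<forall>k. \<bar>e (n + k * q) - e n\<bar> < \<epsilon>"
proof -
  have "\<exists>N. \<forall>n\<ge>N. norm (\<bar>e n - a n\<bar> - 0) < \<epsilon> / 2"
    using LIMSEQ_D[OF lim, of "\<epsilon> / 2"] \<open>\<epsilon> > 0\<close> by simp
  then obtain N where N: "\<And>n. n \<ge> N \<Longrightarrow> \<bar>e n - a n\<bar> < \<epsilon> / 2"
    by auto
  have a: "a (n + k * q) = a n" for n k
  proof (induction k)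
    case (Suc k)
    then show ?case using per[of "n + k * q"] by (simp add: algebra_simps)
  qed simp
  have "\<bar>e (n + k * q) - e n\<bar> < \<epsilon>" if "n > N" for n k
    proof -
    have "\<bar>e n - a n\<bar> < \<epsilon> / 2" "\<bar>e (n + k * q) - a n\<bar> < \<epsilon> / 2"
      using N[of n] N[of "n + k * q"] that a[of n k] by simp_all
    then show ?thesis by linarith
  qed
  then show ?thesis by blast
qed

section \<open>Increasing maps of the line that commute with integer translations\<close>

locale degree_one_map =
  fixes F :: "real \<Rightarrow> real"
  assumes continuous: "continuous_on UNIV F"
    and increasing: "strict_mono F"
    and commutes_with_1: "F (x + 1) = F x + 1"
begin

lemma commutes_with_int: "F (x + of_int m) = F x + of_int m"
proof -
  have nat: "F (x + of_nat k) = F x + of_nat k" for x k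
  proof (induction k)
    case (Suc k)
    then show ?case using commutes_with_1[of "x + of_nat k"] by (simp add: add_ac)
  qed simp
  show ?thesis
  proof (cases "m \<ge> 0")
    case True
    then show ?thesis using nat[of x "nat m"] by simp
  next
    case False
    then show ?thesis using nat[of "x + of_int m" "nat (- m)"] by simp
  qed
qed

lemma funpow_degree_one: "degree_one_map (F ^^ n)"
proof (induction n)
  case 0
  show ?case by unfold_locales (auto simp: strict_mono_def)
next
  case (Suc n)
  then interpret Fn: degree_one_map "F ^^ n" .
  show ?case
  proof
    show "continuous_on UNIV (F ^^ Suc n)"
      using continuous_on_compose2[OF continuous Fn.continuous] by (simp add: o_def)
    show "strict_mono (F ^^ Suc n)"
      using increasing Fn.increasing by (simp add: strict_mono_def)
    show "(F ^^ Suc n) (x + 1) = (F ^^ Suc n) x + 1" for x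
      using Fn.commutes_with_1 commutes_with_1 by simp
  qed
qed

lemma translate_degree_one: "degree_one_map (\<lambda>x. F x + of_int m)"
proof
  show "continuous_on UNIV (\<lambda>x. F x + of_int m)"
    using continuous by (intro continuous_intros)
  show "strict_mono (\<lambda>x. F x + of_int m)"
    using increasing by (simp add: strict_mono_def)
qed (simp add: commutes_with_1)

lemma funpow_translate:
  "((\<lambda>x. F x + of_int m) ^^ n) x = (F ^^ n) x + of_nat n * of_int m"
proof (induction n)
  case (Suc n)
  then show ?case
    using commutes_with_int[of "(F ^^ n) x" "int n * m"] by (simp add: algebra_simps)
qed simp

lemma isCont: "isCont F x"
  using continuous by (simp add: continuous_on_eq_continuous_at)

text \<open>The displacement is \<open>1\<close>-periodic, so it is enough to compare two points \<open>x \<le> y < x + 1\<close>,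
  and then \<open>F x \<le> F y < F x + 1\<close>.\<close>

lemma displacement_oscillation: "\<bar>(F x - x) - (F y - y)\<bar> < 1"
proof -
  define z where "z = y + of_int \<lfloor>x - y\<rfloor>"
  have z: "z \<le> x" "x < z + 1"
    unfolding z_def by linarith+
  have "F z \<le> F x" "F x < F z + 1"
    using z strict_monoD[OF increasing, of x "z + 1"] commutes_with_1[of z]
    by (auto simp: strict_mono_less_eq[OF increasing])
  moreover have "F z - z = F y - y"
    unfolding z_def by (simp add: commutes_with_int)
  ultimately show ?thesis using z by linarith
qed

lemma funpow_displacement_approx: "\<bar>(F ^^ n) x - x - of_nat n * (F y - y)\<bar> \<le> of_nat n"
proof (induction n)
  case (Suc n)
  then show ?case
    using displacement_oscillation[of "(F ^^ n) x" y] by (simp add: algebra_simps)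
qed simp

text \<open>Poincare's theorem. Comparing \<open>F\<^sup>m\<^sup>n\<close> with \<open>n\<close> times the displacement of \<open>F\<^sup>m\<close>, and with
  \<open>m\<close> times that of \<open>F\<^sup>n\<close>, the mean displacements after \<open>m\<close> and \<open>n\<close> steps differ by at most
  \<open>1/m + 1/n\<close>, so they form a Cauchy sequence.\<close>

lemma drift_converges:
  obtains L where "\<And>x. (\<lambda>n. (F ^^ n) x / real n) \<longlonglongrightarrow> L"
proof -
  define a where "a n = (F ^^ n) 0 / real n" for n
  have half: "\<bar>a (m * n) - a m\<bar> \<le> 1 / real m" if "m \<ge> 1" "n \<ge> 1" for m n
  proof -
    interpret Fm: degree_one_map "F ^^ m" by (rule funpow_degree_one)
    have mn: "real (m * n) > 0" using that by simp
    have "\<bar>(F ^^ (m * n)) 0 - real n * (F ^^ m) 0\<bar> \<le> real n"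
      using Fm.funpow_displacement_approx[of n 0 0] by (simp add: funpow_mult)
    then have "\<bar>((F ^^ (m * n)) 0 - real n * (F ^^ m) 0) / real (m * n)\<bar> \<le> real n / real (m * n)"
      using mn by (simp only: abs_divide abs_of_pos divide_right_mono)
    then show ?thesis using that by (simp add: a_def diff_divide_distrib)
  qed
  have diff: "\<bar>a m - a n\<bar> \<le> 1 / real m + 1 / real n" if "m \<ge> 1" "n \<ge> 1" for m n
    using half[OF that] half[OF that(2,1)] by (simp add: mult.commute)
  have "Cauchy a"
  proof (rule metric_CauchyI)
    fix e :: real assume e: "e > 0"
    obtain M :: nat where M: "2 / e < M" using reals_Archimedean2 by blast
    then have M0: "real M > 0" using e by (meson divide_pos_pos less_trans zero_less_numeral)
    have "dist (a m) (a n) < e" if "m \<ge> M" "n \<ge> M" for m n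
    proof -
      have "1 / real m \<le> 1 / real M" "1 / real n \<le> 1 / real M"
        using that M0 by (auto intro!: divide_left_mono mult_pos_pos)
      moreover have "2 / real M < e" using M M0 e by (simp add: field_simps)
      ultimately show ?thesis
        using diff[of m n] that M0 by (simp add: dist_real_def)
    qed
    then show "\<exists>M. \<forall>m\<ge>M. \<forall>n\<ge>M. dist (a m) (a n) < e" by blast
  qed
  then obtain L where L: "a \<longlonglongrightarrow> L"
    using Cauchy_convergent_iff convergent_def by blast
  have "(\<lambda>n. (F ^^ n) x / real n) \<longlonglongrightarrow> L" for x
  proof -
    have "(\<lambda>n. (F ^^ n) x / real n - a n) \<longlonglongrightarrow> 0"
    proof (rule Lim_null_comparison)
      show "(\<lambda>n. (\<bar>x\<bar> + 1) / real n) \<longlonglongrightarrow> 0" by (rule lim_const_over_n)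
      have "\<bar>(F ^^ n) x - (F ^^ n) 0\<bar> \<le> \<bar>x\<bar> + 1" for n
        using degree_one_map.displacement_oscillation[OF funpow_degree_one, of n x 0] by linarith
      then have "norm ((F ^^ n) x / real n - a n) \<le> (\<bar>x\<bar> + 1) / real n" for n
        unfolding a_def diff_divide_distrib[symmetric] real_norm_def abs_divide
        by (simp add: divide_right_mono)
      then show "\<forall>\<^sub>F n in sequentially. norm ((F ^^ n) x / real n - a n) \<le> (\<bar>x\<bar> + 1) / real n"
        by simp
    qed
    from tendsto_add[OF this L] show ?thesis by simp
  qed
  then show thesis by (rule that)
qed

lemma fixed_point_of_zero_drift:
  assumes drift: "(\<lambda>n. (F ^^ n) 0 / real n) \<longlonglongrightarrow> 0"
  obtains y where "F y = y"
proof (rule ccontr)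
  assume "\<not> thesis"
  then have nofix: "F x - x \<noteq> 0" for x using that by auto
  have cont: "continuous_on S (\<lambda>x. F x - x)" for S
    using continuous_on_subset[OF continuous] by (intro continuous_intros) auto
  have iv: "\<exists>x. F x - x = 0" if "F y - y < 0" "F z - z > 0" for y z
  proof -
    have "connected ((\<lambda>x. F x - x) ` UNIV)"
      using cont by (intro connected_continuous_image) auto
    then have "0 \<in> (\<lambda>x. F x - x) ` UNIV"
      using connectedD_interval[of _ "F y - y" "F z - z" 0] that by auto
    then show ?thesis by force
  qed
  have "\<exists>x\<in>{0..1}. \<forall>y\<in>{0..1}. \<bar>F x - x\<bar> \<le> \<bar>F y - y\<bar>"
    by (intro continuous_attains_inf continuous_on_rabs cont) auto
  then obtain x0 where x0: "\<And>y. y \<in> {0..1} \<Longrightarrow> \<bar>F x0 - x0\<bar> \<le> \<bar>F y - y\<bar>"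
    by blast
  define \<delta> where "\<delta> = \<bar>F x0 - x0\<bar>"
  have \<delta>: "\<delta> > 0" using nofix[of x0] by (simp add: \<delta>_def)
  have \<delta>_le: "\<delta> \<le> \<bar>F x - x\<bar>" for x
  proof -
    have "F (x + of_int (- \<lfloor>x\<rfloor>)) - (x + of_int (- \<lfloor>x\<rfloor>)) = F x - x"
      by (subst commutes_with_int) simp
    moreover have "x + of_int (- \<lfloor>x\<rfloor>) \<in> {0..1}"
      by simp linarith
    ultimately show ?thesis using x0 unfolding \<delta>_def by metis
  qed
  have sign: "(\<forall>x. F x - x > 0) \<or> (\<forall>x. F x - x < 0)"
  proof (rule ccontr)
    assume "\<not> ?thesis"
    then obtain y z where "\<not> F y - y < 0" "\<not> F z - z > 0" by blast
    then have "F y - y > 0" "F z - z < 0"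
      using nofix[of y] nofix[of z] by linarith+
    then show False using iv[of z y] nofix by blast
  qed
  have "\<bar>(F ^^ n) 0\<bar> \<ge> real n * \<delta>" for n
    using sign
  proof
    assume pos: "\<forall>x. F x - x > 0"
    have "(F ^^ n) 0 \<ge> real n * \<delta>"
    proof (induction n)
      case (Suc n)
      then show ?case
        using \<delta>_le[of "(F ^^ n) 0"] pos[rule_format, of "(F ^^ n) 0"] by (simp add: algebra_simps)
    qed simp
    then show ?thesis by linarith
  next
    assume neg: "\<forall>x. F x - x < 0"
    have "- (F ^^ n) 0 \<ge> real n * \<delta>"
    proof (induction n)
      case (Suc n)
      then show ?case
        using \<delta>_le[of "(F ^^ n) 0"] neg[rule_format, of "(F ^^ n) 0"] by (simp add: algebra_simps)
    qed simp
    then show ?thesis by linarith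
  qed
  then have "\<forall>\<^sub>F n in sequentially. \<delta> \<le> \<bar>(F ^^ n) 0 / real n\<bar>"
    by (intro eventually_sequentiallyI[of 1]) (simp add: field_simps)
  from tendsto_lowerbound[OF tendsto_rabs[OF drift] this] show False
    using \<delta> by simp
qed

text \<open>The integer translates of a fixed point are fixed too and are unbounded in both directions;
  an orbit cannot cross them, and it is monotone because \<open>F\<close> is increasing.\<close>

lemma orbit_converges_to_fixed_point:
  assumes fix0: "F y0 = y0"
  obtains y where "F y = y" "(\<lambda>n. (F ^^ n) x) \<longlonglongrightarrow> y"
proof -
  define N where "N = \<lceil>\<bar>x - y0\<bar>\<rceil>"
  have N: "y0 + of_int (- N) \<le> x" "x \<le> y0 + of_int N"
    unfolding N_def by linarith+
  have translates: "(F ^^ n) (y0 + of_int m) = y0 + of_int m" for n m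
    by (induction n) (simp_all add: fix0 commutes_with_int)
  have mono: "mono (F ^^ n)" for n
    using degree_one_map.increasing[OF funpow_degree_one] by (rule strict_mono_mono)
  have bounds: "y0 - of_int N \<le> (F ^^ n) x" "(F ^^ n) x \<le> y0 + of_int N" for n
    using monoD[OF mono N(1), of n] monoD[OF mono N(2), of n] translates[of n N] translates[of n "- N"]
    by simp_all
  have "\<exists>y. (\<lambda>n. (F ^^ n) x) \<longlonglongrightarrow> y"
  proof (cases "x \<le> F x")
    case True
    then have "incseq (\<lambda>n. (F ^^ n) x)"
      using monoD[OF mono True] by (intro incseq_SucI) (simp add: funpow_swap1)
    then show ?thesis using incseq_convergent bounds(2) by metis
  next
    case False
    then have "F x \<le> x" by simp
    then have "decseq (\<lambda>n. (F ^^ n) x)"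
      using monoD[OF mono, of "F x" x] by (intro decseq_SucI) (simp add: funpow_swap1)
    then show ?thesis using decseq_convergent bounds(1) by metis
  qed
  then obtain y where y: "(\<lambda>n. (F ^^ n) x) \<longlonglongrightarrow> y" ..
  have "(\<lambda>n. (F ^^ Suc n) x) \<longlonglongrightarrow> F y"
    using isCont_tendsto_compose[OF isCont y] by simp
  moreover have "(\<lambda>n. (F ^^ Suc n) x) \<longlonglongrightarrow> y"
    using LIMSEQ_Suc[OF y] .
  ultimately have "F y = y" using LIMSEQ_unique by blast
  then show thesis using y by (rule that)
qed

lemma orbit_displacement_constant_sign:
  "(\<forall>n. F ((F ^^ n) x) - (F ^^ n) x \<ge> 0) \<or> (\<forall>n. F ((F ^^ n) x) - (F ^^ n) x < 0)"
proof -
  have mono: "strict_mono (F ^^ n)" for n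
    using degree_one_map.increasing[OF funpow_degree_one] .
  show ?thesis
  proof (cases "x \<le> F x")
    case True
    then show ?thesis
      using strict_mono_less_eq[OF mono, of _ x "F x"] by (simp add: funpow_swap1)
  next
    case False
    then show ?thesis
      using strict_mono_less[OF mono, of _ "F x" x] by (simp add: funpow_swap1)
  qed
qed

text \<open>Here \<open>F - m\<close> has the fixed point \<open>w\<close> and the displacements tend to the integer \<open>m\<close>,
  where the fractional part jumps; monotone orbits keep them on one side of \<open>m\<close>.\<close>

lemma frac_displacement_converges:
  assumes "F w = w + of_int m"
  shows "convergent (\<lambda>n. frac (displacement F ((F ^^ n) x)))"
proof -
  define G where "G = (\<lambda>x. F x + of_int (- m))"
  interpret G: degree_one_map G
    unfolding G_def by (rule translate_degree_one)
  define d where "d n = G ((G ^^ n) x) - (G ^^ n) x" for n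
  have "G w = w" using assms by (simp add: G_def)
  then obtain y where y: "(\<lambda>n. (G ^^ n) x) \<longlonglongrightarrow> y"
    using G.orbit_converges_to_fixed_point by metis
  have "d \<longlonglongrightarrow> 0"
    unfolding d_def using tendsto_diff[OF LIMSEQ_Suc[OF y] y] by simp
  then have "convergent (\<lambda>n. frac (d n))"
    using G.orbit_displacement_constant_sign[of x]
    by (intro convergent_frac_of_one_sided_null \<open>d \<longlonglongrightarrow> 0\<close>) (simp add: d_def)
  moreover have "frac (d n) = frac (displacement F ((F ^^ n) x))" for n
  proof -
    have "(G ^^ n) x = (F ^^ n) x + of_int (int n * - m)"
      using funpow_translate[where m = "- m"] by (simp add: G_def)
    then have "displacement F ((F ^^ n) x) = d n + of_int m"
      unfolding d_def displacement_def by (simp only: G_def commutes_with_int)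
    then show ?thesis by simp
  qed
  ultimately show ?thesis by simp
qed

text \<open>The subsequence converges to the displacement at some point \<open>w\<close>. If that is an integer,
  \<open>w\<close> is of the kind required by \<open>frac_displacement_converges\<close>; otherwise the fractional part
  is continuous there.\<close>

lemma frac_displacement_converges_subseq:
  assumes q: "q \<ge> 1" and drift: "(\<lambda>n. (F ^^ n) 0 / real n) \<longlonglongrightarrow> of_int p / real q"
  shows "convergent (\<lambda>k. frac (displacement F ((F ^^ (k * q + j)) x)))"
proof -
  interpret Fq: degree_one_map "F ^^ q" by (rule funpow_degree_one)
  define G where "G = (\<lambda>x. (F ^^ q) x + of_int (- p))"
  interpret G: degree_one_map G
    unfolding G_def by (rule Fq.translate_degree_one)
  have Gk: "(G ^^ k) x = (F ^^ (k * q)) x + of_int (int k * - p)" for k x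
    using Fq.funpow_translate[where m = "- p"] by (simp add: G_def funpow_mult mult.commute)
  have "(\<lambda>k. (G ^^ k) 0 / real k) \<longlonglongrightarrow> 0"
  proof -
    have "strict_mono (\<lambda>k. k * q)" using q by (simp add: strict_mono_def)
    from LIMSEQ_subseq_LIMSEQ[OF drift this]
    have "(\<lambda>k. (F ^^ (k * q)) 0 / real (k * q)) \<longlonglongrightarrow> of_int p / real q"
      by (simp add: o_def)
    then have "(\<lambda>k. real q * ((F ^^ (k * q)) 0 / real (k * q)) - of_int p)
        \<longlonglongrightarrow> real q * (of_int p / real q) - of_int p"
      by (rule tendsto_diff[OF tendsto_mult_left tendsto_const])
    then have "(\<lambda>k. real q * ((F ^^ (k * q)) 0 / real (k * q)) - of_int p) \<longlonglongrightarrow> 0"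
      using q by simp
    moreover have "\<forall>\<^sub>F k in sequentially.
        real q * ((F ^^ (k * q)) 0 / real (k * q)) - of_int p = (G ^^ k) 0 / real k"
      using q by (intro eventually_sequentiallyI[of 1]) (simp add: Gk field_simps)
    ultimately show ?thesis by (rule Lim_transform_eventually)
  qed
  then obtain y0 where "G y0 = y0" using G.fixed_point_of_zero_drift by metis
  then obtain y where y: "(\<lambda>k. (G ^^ k) x) \<longlonglongrightarrow> y"
    using G.orbit_converges_to_fixed_point by metis
  interpret Fj: degree_one_map "F ^^ j" by (rule funpow_degree_one)
  define w where "w = (F ^^ j) y"
  have w: "(\<lambda>k. (F ^^ j) ((G ^^ k) x)) \<longlonglongrightarrow> w"
    unfolding w_def using isCont_tendsto_compose[OF Fj.isCont y] .
  have disp: "displacement F ((F ^^ j) ((G ^^ k) x)) = displacement F ((F ^^ (k * q + j)) x)" for k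
  proof -
    have "(F ^^ j) ((G ^^ k) x) = (F ^^ (k * q + j)) x + of_int (int k * - p)"
      by (simp only: Gk Fj.commutes_with_int add.commute[of "k * q"] funpow_add o_apply)
    then show ?thesis
      by (simp only: displacement_def commutes_with_int)
  qed
  have lim: "(\<lambda>k. displacement F ((F ^^ (k * q + j)) x)) \<longlonglongrightarrow> displacement F w"
    unfolding disp[symmetric] unfolding displacement_def
    by (rule tendsto_diff[OF isCont_tendsto_compose[OF isCont w] w])
  show ?thesis
  proof (cases "displacement F w \<in> \<int>")
    case True
    then obtain m where "F w = w + of_int m"
      by (auto simp: displacement_def elim!: Ints_cases) (metis add.commute diff_eq_eq)
    then have "convergent (\<lambda>n. frac (displacement F ((F ^^ n) x)))"
      by (rule frac_displacement_converges)
    moreover have "strict_mono (\<lambda>k. k * q + j)" using q by (simp add: strict_mono_def)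
    ultimately show ?thesis
      using convergent_subseq_convergent[of "\<lambda>n. frac (displacement F ((F ^^ n) x))"]
      by (simp add: o_def)
  next
    case False
    show ?thesis
      using isCont_tendsto_compose[OF continuous_frac[OF False] lim] by (rule convergentI)
  qed
qed

end

section \<open>Lifts of circle homeomorphisms\<close>

lemma circle_cover_eq_iff: "circle_cover x = circle_cover y \<longleftrightarrow> (\<exists>m::int. x = y + of_int m)"
proof -
  have "2 * of_real pi * \<i> * of_real x = 2 * of_real pi * \<i> * of_real y + (of_int (2 * m) * pi) * \<i>
      \<longleftrightarrow> x = y + of_int m" for m :: int
  proof -
    have "2 * of_real pi * \<i> * of_real y + (of_int (2 * m) * pi) * \<i>
        = 2 * of_real pi * \<i> * of_real (y + of_int m)"
      by (simp add: algebra_simps)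
    then show ?thesis
      by (simp only: mult_cancel_left of_real_eq_iff) simp
  qed
  then show ?thesis unfolding circle_cover_def exp_eq by simp
qed

lemma circle_cover_in_sphere: "circle_cover x \<in> sphere 0 1"
  by (simp add: circle_cover_def norm_exp_eq_Re)

lemma circle_cover_surj:
  assumes "z \<in> sphere 0 1"
  obtains x where "circle_cover x = z"
proof -
  have "circle_cover (Arg2pi z / (2 * pi)) = exp (\<i> * of_real (Arg2pi z))"
    by (simp add: circle_cover_def)
  also have "\<dots> = z" using assms by (simp add: complex_norm_eq_1_exp[symmetric])
  finally show thesis by (rule that)
qed

lemma continuous_int_valued_constant:
  fixes f :: "real \<Rightarrow> real"
  assumes "continuous_on UNIV f" "\<And>x. f x \<in> \<int>"
  obtains m :: int where "\<And>x. f x = of_int m"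
proof -
  have "f constant_on UNIV"
  proof (rule continuous_discrete_range_constant)
    show "\<exists>e>0. \<forall>y. y \<in> UNIV \<and> f y \<noteq> f x \<longrightarrow> e \<le> norm (f y - f x)" for x
      using assms(2) Ints_nonzero_abs_ge1[OF Ints_diff[OF assms(2) assms(2)]]
      by (intro exI[of _ 1]) auto
  qed (use assms in auto)
  then obtain c where c: "\<And>x. f x = c" by (auto simp: constant_on_def)
  then obtain m where "c = of_int m" using assms(2) Ints_cases by metis
  then show thesis using c that by simp
qed

lemma lifts_differ_by_int:
  assumes "is_lift \<phi> F" "is_lift \<phi> G"
  obtains m :: int where "\<And>x. G x = F x + of_int m"
proof -
  have "continuous_on UNIV (\<lambda>x. G x - F x)"
    using assms by (auto simp: is_lift_def intro!: continuous_intros)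
  moreover have "G x - F x \<in> \<int>" for x
  proof -
    have "circle_cover (G x) = circle_cover (F x)" using assms by (simp add: is_lift_def)
    then show ?thesis by (auto simp: circle_cover_eq_iff)
  qed
  ultimately obtain m :: int where "\<And>x. G x - F x = of_int m"
    using continuous_int_valued_constant by blast
  then show thesis by (intro that[of m]) (simp add: algebra_simps)
qed

text \<open>The difference \<open>F (x + 1) - F x\<close> is a constant positive integer. It is not larger than \<open>1\<close>:
  otherwise \<open>F\<close> would take the value \<open>F 0 + 1\<close> strictly between \<open>0\<close> and \<open>1\<close>, against the
  injectivity of the circle map.\<close>

lemma increasing_lift_degree_one:
  assumes homeo: "circle_homeo \<phi>" and lift: "is_lift \<phi> F" and mono: "strict_mono F"
  shows "degree_one_map F"
proof -
  have cont: "continuous_on UNIV F" and cover: "\<And>x. circle_cover (F x) = \<phi> (circle_cover x)"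
    using lift by (auto simp: is_lift_def)
  have "continuous_on UNIV (\<lambda>x. F (x + 1) - F x)"
    using cont by (auto intro!: continuous_intros continuous_on_compose2[OF cont])
  moreover have "F (x + 1) - F x \<in> \<int>" for x
  proof -
    have "circle_cover (x + 1) = circle_cover x"
      unfolding circle_cover_eq_iff by (intro exI[of _ 1]) simp
    then have "circle_cover (F (x + 1)) = circle_cover (F x)" by (simp add: cover)
    then show ?thesis by (auto simp: circle_cover_eq_iff)
  qed
  ultimately obtain d :: int where d: "\<And>x. F (x + 1) - F x = of_int d"
    using continuous_int_valued_constant by blast
  have "(of_int d :: real) > 0"
    using d[of 0] strict_monoD[OF mono, of 0 1] by simp
  then have "d \<ge> 1" by simp
  moreover have "\<not> d \<ge> 2"
  proof
    assume "d \<ge> 2"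
    then have "F 0 \<le> F 0 + 1" "F 0 + 1 \<le> F 1" using d[of 0] by auto
    then obtain y where y: "0 \<le> y" "y \<le> 1" "F y = F 0 + 1"
      using IVT'[of F 0 "F 0 + 1" 1] continuous_on_subset[OF cont] by auto
    then have "y \<noteq> 0" "y \<noteq> 1" using d[of 0] \<open>d \<ge> 2\<close> by auto
    have "circle_cover (F y) = circle_cover (F 0)"
      unfolding circle_cover_eq_iff y(3) by (intro exI[of _ 1]) simp
    moreover have "inj_on \<phi> (sphere 0 1)"
      using homeo unfolding circle_homeo_def homeomorphism_def by (metis inj_on_inverseI)
    ultimately have "circle_cover y = circle_cover 0"
      using circle_cover_in_sphere by (auto simp: cover dest: inj_onD)
    then obtain m :: int where "y = of_int m" by (auto simp: circle_cover_eq_iff)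
    then show False using y \<open>y \<noteq> 0\<close> \<open>y \<noteq> 1\<close> by auto
  qed
  ultimately have "d = 1" by simp
  then show ?thesis
    using cont mono d by unfold_locales (simp_all add: algebra_simps)
qed

lemma rotation_number_eq_frac_drift:
  assumes lift: "is_lift \<phi> F" and "degree_one_map F"
    and L: "\<And>x. (\<lambda>n. (F ^^ n) x / real n) \<longlonglongrightarrow> L"
  shows "rotation_number \<phi> = frac L"
  unfolding rotation_number_def
proof (rule the_equality)
  interpret degree_one_map F by fact
  show "\<forall>\<Phi> x. is_lift \<phi> \<Phi> \<longrightarrow>
      (\<exists>M. (\<lambda>n. (\<Phi> ^^ n) x / real n) \<longlonglongrightarrow> M \<and> frac L = frac M)"
  proof (intro allI impI)
    fix \<Phi> x assume "is_lift \<phi> \<Phi>"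
    then obtain m :: int where "\<And>x. \<Phi> x = F x + of_int m"
      using lifts_differ_by_int[OF lift] by blast
    then have \<Phi>: "\<Phi> = (\<lambda>x. F x + of_int m)" by blast
    have "(\<lambda>n. (F ^^ n) x / real n + of_int m) \<longlonglongrightarrow> L + of_int m"
      by (intro tendsto_intros L)
    moreover have "\<forall>\<^sub>F n in sequentially.
        (F ^^ n) x / real n + of_int m = (\<Phi> ^^ n) x / real n"
      by (intro eventually_sequentiallyI[of 1]) (simp add: \<Phi> funpow_translate field_simps)
    ultimately have "(\<lambda>n. (\<Phi> ^^ n) x / real n) \<longlonglongrightarrow> L + of_int m"
      by (rule Lim_transform_eventually)
    then show "\<exists>M. (\<lambda>n. (\<Phi> ^^ n) x / real n) \<longlonglongrightarrow> M \<and> frac L = frac M"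
      by (intro exI[of _ "L + of_int m"]) simp
  qed
next
  fix \<rho>
  assume "\<forall>\<Phi> x. is_lift \<phi> \<Phi> \<longrightarrow> (\<exists>M. (\<lambda>n. (\<Phi> ^^ n) x / real n) \<longlonglongrightarrow> M \<and> \<rho> = frac M)"
  then obtain M where "(\<lambda>n. (F ^^ n) 0 / real n) \<longlonglongrightarrow> M" "\<rho> = frac M"
    using lift by blast
  then show "\<rho> = frac L" using LIMSEQ_unique[OF _ L] by blast
qed

lemma displacement_seq_eq:
  assumes lift: "is_lift \<phi> F" and "degree_one_map F" and x: "circle_cover x = z"
  shows "displacement_seq \<phi> z n = frac (displacement F ((F ^^ (n - 1)) x))"
  unfolding displacement_seq_def
proof (rule the_equality)
  interpret degree_one_map F by fact
  interpret Fn: degree_one_map "F ^^ (n - 1)" by (rule funpow_degree_one)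
  show "\<forall>\<Phi> y. is_lift \<phi> \<Phi> \<and> circle_cover y = z \<longrightarrow>
      frac (displacement F ((F ^^ (n - 1)) x)) = frac (displacement \<Phi> ((\<Phi> ^^ (n - 1)) y))"
  proof (intro allI impI, elim conjE)
    fix \<Phi> y assume "is_lift \<phi> \<Phi>" and y: "circle_cover y = z"
    then obtain m :: int where "\<And>x. \<Phi> x = F x + of_int m"
      using lifts_differ_by_int[OF lift] by blast
    then have \<Phi>: "\<Phi> = (\<lambda>x. F x + of_int m)" by blast
    obtain l :: int where l: "y = x + of_int l"
      using x y circle_cover_eq_iff by metis
    have "(\<Phi> ^^ (n - 1)) y = (F ^^ (n - 1)) x + of_int (l + int (n - 1) * m)"
      unfolding \<Phi> funpow_translate l Fn.commutes_with_int by simp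
    then have "displacement \<Phi> ((\<Phi> ^^ (n - 1)) y)
        = displacement F ((F ^^ (n - 1)) x) + of_int m"
      unfolding displacement_def by (simp only: \<Phi> commutes_with_int)
    then show "frac (displacement F ((F ^^ (n - 1)) x))
        = frac (displacement \<Phi> ((\<Phi> ^^ (n - 1)) y))"
      by simp
  qed
qed (use lift x in blast)

section \<open>Displacement sequences for rational rotation numbers\<close>

text \<open>The rotation number is only a fractional part, so the drift of a lift is \<open>p / q\<close> up to an
  integer, which is absorbed into \<open>p\<close>.\<close>

lemma displacement_seq_asymptotically_periodic:
  assumes or: "orientation_preserving_circle_homeo \<phi>"
    and q: "q \<ge> 1" and rot: "rotation_number \<phi> = of_int p / of_nat q"
    and z: "z \<in> sphere 0 1"
  obtains a where "\<And>n. a (n + q) = a n" "(\<lambda>n. \<bar>displacement_seq \<phi> z n - a n\<bar>) \<longlonglongrightarrow> 0"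
proof -
  obtain F where lift: "is_lift \<phi> F" and mono: "strict_mono F" and homeo: "circle_homeo \<phi>"
    using or by (auto simp: orientation_preserving_circle_homeo_def)
  interpret degree_one_map F
    using homeo lift mono by (rule increasing_lift_degree_one)
  obtain L where L: "\<And>x. (\<lambda>n. (F ^^ n) x / real n) \<longlonglongrightarrow> L"
    using drift_converges by blast
  have "frac L = of_int p / real q"
    using rot rotation_number_eq_frac_drift[OF lift degree_one_map_axioms L] by simp
  then have "L = of_int (p + \<lfloor>L\<rfloor> * int q) / real q"
    using q by (simp add: frac_def field_simps)
  then have drift: "(\<lambda>n. (F ^^ n) 0 / real n) \<longlonglongrightarrow> of_int (p + \<lfloor>L\<rfloor> * int q) / real q"
    using L[of 0] by simp
  obtain x where x: "circle_cover x = z" using circle_cover_surj[OF z] .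
  define e where "e n = frac (displacement F ((F ^^ n) x))" for n
  have "convergent (\<lambda>k. e (k * q + j))" for j
    unfolding e_def using q drift by (rule frac_displacement_converges_subseq)
  then obtain a where a: "\<And>n. a (n + q) = a n" and lim: "(\<lambda>n. \<bar>e n - a n\<bar>) \<longlonglongrightarrow> 0"
    using asymptotically_periodic_of_convergent_residue_classes[OF q] by metis
  have eta: "displacement_seq \<phi> z (Suc n) = e n" for n
    using displacement_seq_eq[OF lift degree_one_map_axioms x] by (simp add: e_def)
  \<comment> \<open>The displacement sequence lags one step behind \<open>e\<close>; shifting \<open>a\<close> forward by \<open>q - 1\<close>
    rather than back by \<open>1\<close> avoids the index \<open>-1\<close>.\<close>
  define b where "b n = a (n + (q - 1))" for n
  have "b (Suc n) = a n" for n
    using q a[of n] by (simp add: b_def)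
  then have "(\<lambda>n. \<bar>displacement_seq \<phi> z (Suc n) - b (Suc n)\<bar>) \<longlonglongrightarrow> 0"
    using lim by (simp add: eta)
  then have "(\<lambda>n. \<bar>displacement_seq \<phi> z n - b n\<bar>) \<longlonglongrightarrow> 0"
    by (rule LIMSEQ_imp_Suc)
  moreover have "b (n + q) = b n" for n
    using a[of "n + (q - 1)"] by (simp add: b_def add_ac)
  ultimately show thesis by (rule that[rotated])
qed

theorem proposition2p5:
  fixes \<phi> :: "complex \<Rightarrow> complex"
  assumes "semi_periodic \<phi>"
  shows "(\<forall>z\<in>sphere 0 1.
            asymptotically_periodic (displacement_seq \<phi> z) \<and>
            asymptotically_semi_periodic (displacement_seq \<phi> z)) \<and>
         (\<forall>(p::int) (q::nat). q \<ge> 1 \<longrightarrow> rotation_number \<phi> = of_int p / of_nat q \<longrightarrow>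
            (\<forall>z\<in>sphere 0 1. \<forall>\<epsilon>>0. \<exists>N. \<forall>n>N. \<forall>k.
               \<bar>displacement_seq \<phi> z (n + k * q) - displacement_seq \<phi> z n\<bar> < \<epsilon>))"
proof -
  have or: "orientation_preserving_circle_homeo \<phi>" and rat: "rotation_number \<phi> \<in> \<rat>"
    using assms by (auto simp: semi_periodic_def)
  have uniform: "\<exists>N. \<forall>n>N. \<forall>k. \<bar>displacement_seq \<phi> z (n + k * q) - displacement_seq \<phi> z n\<bar> < \<epsilon>"
    if pq: "q \<ge> 1" "rotation_number \<phi> = of_int p / of_nat q" and z: "z \<in> sphere 0 1" and "\<epsilon> > 0"
    for p :: int and q :: nat and z \<epsilon>
  proof -
    obtain a where "\<And>n. a (n + q) = a n" "(\<lambda>n. \<bar>displacement_seq \<phi> z n - a n\<bar>) \<longlonglongrightarrow> 0"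
      using displacement_seq_asymptotically_periodic[OF or pq z] by blast
    then show ?thesis
      using \<open>\<epsilon> > 0\<close> by (rule uniformly_almost_periodic_of_asymptotically_periodic)
  qed
  obtain p :: int and q :: nat where q: "q \<ge> 1" and rot: "rotation_number \<phi> = of_int p / of_nat q"
  proof -
    obtain a b :: int where "b > 0" "rotation_number \<phi> = of_int a / of_int b"
      using rat by (auto elim: Rats_cases')
    then show thesis by (intro that[of "nat b" a]) auto
  qed
  have "asymptotically_periodic (displacement_seq \<phi> z)" if z: "z \<in> sphere 0 1" for z
  proof -
    obtain a where "\<And>n. a (n + q) = a n" "(\<lambda>n. \<bar>displacement_seq \<phi> z n - a n\<bar>) \<longlonglongrightarrow> 0"
      using displacement_seq_asymptotically_periodic[OF or q rot z] by blast
    then show ?thesis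
      unfolding asymptotically_periodic_def using q by blast
  qed
  moreover have "asymptotically_semi_periodic (displacement_seq \<phi> z)" if z: "z \<in> sphere 0 1" for z
    unfolding asymptotically_semi_periodic_def
  proof (intro allI impI)
    fix \<epsilon> :: real assume "\<epsilon> > 0"
    then obtain N where
      "\<forall>n>N. \<forall>k. \<bar>displacement_seq \<phi> z (n + k * q) - displacement_seq \<phi> z n\<bar> < \<epsilon>"
      using uniform[OF q rot z] by blast
    then show "\<exists>N. \<exists>r\<ge>1. \<forall>n>N. \<forall>k.
        \<bar>displacement_seq \<phi> z (n + r * k) - displacement_seq \<phi> z n\<bar> < \<epsilon>"
      using q by (intro exI[of _ N] exI[of _ q]) (simp add: mult.commute[of q])
  qed
  ultimately show ?thesis using uniform by blast
qed

end
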